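(* The monoid $\mathscr{I}^{\nearrow}_{\infty}(\mathbb{Z})$ of all injective monotone partial selfmaps of $\mathbb{Z}$ with cofinite domain and cofinite range is a bisimple semigroup.
   Context: A partial map $\alpha\colon\mathbb{Z}\rightharpoonup\mathbb{Z}$ is monotone if $n\leqslant m$ implies $(n)\alpha\leqslant(m)\alpha$ for $n,m\in\operatorname{dom}\alpha$. $\mathscr{I}^{\nearrow}_{\infty}(\mathbb{Z})$ is the set of all injective monotone partial maps $\alpha\colon\mathbb{Z}\rightharpoonup\mathbb{Z}$ with $|\mathbb{Z}\setminus\operatorname{dom}\alpha|<\infty$ and $|\mathbb{Z}\setminus\operatorname{ran}\alpha|<\infty$, with composition $x(\alpha\beta)=(x\alpha)\beta$ for $x\in\operatorname{dom}(\alpha\beta)=\{y\in\operatorname{dom}\alpha\mid y\alpha\in\operatorname{dom}\beta\}$ (maps are written on the right). A semigroup $S$ is bisimple if it has only one $\mathscr{D}$-class, where $\mathscr{D}=\mathscr{L}\circ\mathscr{R}=\mathscr{R}\circ\mathscr{L}$, $a\mathscr{R}b$ iff $aS^1=bS^1$, and $a\mathscr{L}b$ iff $S^1a=S^1b$. *)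

theory Defs
  imports "HOL-Algebra.Group"
begin

text \<open>Semigroups are given by the carrier and multiplication of an HOL-Algebra
  structure; its unit field plays no role in the notions up to bisimplicity.\<close>

definition is_semigroup :: "('a, 'b) monoid_scheme \<Rightarrow> bool" where
  "is_semigroup S \<longleftrightarrow>
     (\<forall>x\<in>carrier S. \<forall>y\<in>carrier S. x \<otimes>\<^bsub>S\<^esub> y \<in> carrier S) \<and>
     (\<forall>x\<in>carrier S. \<forall>y\<in>carrier S. \<forall>z\<in>carrier S.
        (x \<otimes>\<^bsub>S\<^esub> y) \<otimes>\<^bsub>S\<^esub> z = x \<otimes>\<^bsub>S\<^esub> (y \<otimes>\<^bsub>S\<^esub> z))"

text \<open>Whether or not an identity has to be adjoined to form \<open>S\<^sup>1\<close>, one has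
  \<open>a S\<^sup>1 = {a} \<union> a S\<close> and \<open>S\<^sup>1 a = {a} \<union> S a\<close>.\<close>

definition principal_right :: "('a, 'b) monoid_scheme \<Rightarrow> 'a \<Rightarrow> 'a set" where
  "principal_right S a = insert a {a \<otimes>\<^bsub>S\<^esub> s | s. s \<in> carrier S}"

definition principal_left :: "('a, 'b) monoid_scheme \<Rightarrow> 'a \<Rightarrow> 'a set" where
  "principal_left S a = insert a {s \<otimes>\<^bsub>S\<^esub> a | s. s \<in> carrier S}"

definition green_R :: "('a, 'b) monoid_scheme \<Rightarrow> 'a rel" where
  "green_R S = {(a, b). a \<in> carrier S \<and> b \<in> carrier S \<and> principal_right S a = principal_right S b}"

definition green_L :: "('a, 'b) monoid_scheme \<Rightarrow> 'a rel" where
  "green_L S = {(a, b). a \<in> carrier S \<and> b \<in> carrier S \<and> principal_left S a = principal_left S b}"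

definition green_D :: "('a, 'b) monoid_scheme \<Rightarrow> 'a rel" where
  "green_D S = green_L S O green_R S"

definition bisimple :: "('a, 'b) monoid_scheme \<Rightarrow> bool" where
  "bisimple S \<longleftrightarrow> (\<exists>C. carrier S // green_D S = {C})"

text \<open>By \<open>green_D_alt\<close> the order of composition in \<open>green_D\<close> is immaterial, and by
  \<open>equiv_green_D\<close> the quotient in \<open>bisimple\<close> consists of equivalence classes.\<close>

lemma green_L_R_subset:
  assumes "is_semigroup S"
  shows "green_L S O green_R S \<subseteq> green_R S O green_L S"
proof clarify
  fix a c b assume L: "(a, c) \<in> green_L S" and R: "(c, b) \<in> green_R S"
  have car: "a \<in> carrier S" "b \<in> carrier S" "c \<in> carrier S"
    using L R by (auto simp: green_L_def green_R_def)
  have eqL: "principal_left S a = principal_left S c"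
    and eqR: "principal_right S c = principal_right S b"
    using L R by (auto simp: green_L_def green_R_def)
  have cl: "x \<otimes>\<^bsub>S\<^esub> y \<in> carrier S" if "x \<in> carrier S" "y \<in> carrier S" for x y
    using assms that by (auto simp: is_semigroup_def)
  have assoc: "(x \<otimes>\<^bsub>S\<^esub> y) \<otimes>\<^bsub>S\<^esub> z = x \<otimes>\<^bsub>S\<^esub> (y \<otimes>\<^bsub>S\<^esub> z)"
    if "x \<in> carrier S" "y \<in> carrier S" "z \<in> carrier S" for x y z
    using assms that by (auto simp: is_semigroup_def)
  show "(a, b) \<in> green_R S O green_L S"
  proof (cases "a = c \<or> c = b")
    case True
    then show ?thesis using L R car by (auto simp: green_L_def green_R_def)
  next
    case False
    have "a \<in> principal_left S c" "c \<in> principal_left S a"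
      using eqL by (auto simp: principal_left_def)
    then obtain x x' where x: "x \<in> carrier S" "a = x \<otimes>\<^bsub>S\<^esub> c" and x': "x' \<in> carrier S" "c = x' \<otimes>\<^bsub>S\<^esub> a"
      using False by (auto simp: principal_left_def)
    have "c \<in> principal_right S b" "b \<in> principal_right S c"
      using eqR by (auto simp: principal_right_def)
    then obtain y y' where y: "y \<in> carrier S" "c = b \<otimes>\<^bsub>S\<^esub> y" and y': "y' \<in> carrier S" "b = c \<otimes>\<^bsub>S\<^esub> y'"
      using False by (auto simp: principal_right_def)
    define d where "d = a \<otimes>\<^bsub>S\<^esub> y'"
    have d: "d \<in> carrier S" using car y' cl by (simp add: d_def)
    have dx: "d = x \<otimes>\<^bsub>S\<^esub> b" using x y' car assoc d_def by metis
    have ady: "a = d \<otimes>\<^bsub>S\<^esub> y" using dx x y car assoc by metis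
    have bxd: "b = x' \<otimes>\<^bsub>S\<^esub> d" using d_def x' y' car assoc by metis
    have "principal_right S a = principal_right S d"
    proof (intro equalityI subsetI)
      fix z assume "z \<in> principal_right S a"
      then consider "z = a" | s where "s \<in> carrier S" "z = a \<otimes>\<^bsub>S\<^esub> s"
        by (auto simp: principal_right_def)
      then show "z \<in> principal_right S d"
      proof cases
        case 1 then show ?thesis using ady y by (auto simp: principal_right_def)
      next
        case 2 then have "z = d \<otimes>\<^bsub>S\<^esub> (y \<otimes>\<^bsub>S\<^esub> s)" using ady assoc d y by metis
        then show ?thesis using cl y 2 by (auto simp: principal_right_def)
      qed
    next
      fix z assume "z \<in> principal_right S d"
      then consider "z = d" | s where "s \<in> carrier S" "z = d \<otimes>\<^bsub>S\<^esub> s"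
        by (auto simp: principal_right_def)
      then show "z \<in> principal_right S a"
      proof cases
        case 1 then show ?thesis using d_def y' by (auto simp: principal_right_def)
      next
        case 2 then have "z = a \<otimes>\<^bsub>S\<^esub> (y' \<otimes>\<^bsub>S\<^esub> s)" using d_def assoc car y' by metis
        then show ?thesis using cl y' 2 by (auto simp: principal_right_def)
      qed
    qed
    moreover have "principal_left S d = principal_left S b"
    proof (intro equalityI subsetI)
      fix z assume "z \<in> principal_left S d"
      then consider "z = d" | s where "s \<in> carrier S" "z = s \<otimes>\<^bsub>S\<^esub> d"
        by (auto simp: principal_left_def)
      then show "z \<in> principal_left S b"
      proof cases
        case 1 then show ?thesis using dx x by (auto simp: principal_left_def)
      next
        case 2 then have "z = (s \<otimes>\<^bsub>S\<^esub> x) \<otimes>\<^bsub>S\<^esub> b" using dx assoc car x by metis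
        then show ?thesis using cl x 2 by (auto simp: principal_left_def)
      qed
    next
      fix z assume "z \<in> principal_left S b"
      then consider "z = b" | s where "s \<in> carrier S" "z = s \<otimes>\<^bsub>S\<^esub> b"
        by (auto simp: principal_left_def)
      then show "z \<in> principal_left S d"
      proof cases
        case 1 then show ?thesis using bxd x' by (auto simp: principal_left_def)
      next
        case 2 then have "z = (s \<otimes>\<^bsub>S\<^esub> x') \<otimes>\<^bsub>S\<^esub> d" using bxd assoc d x' by metis
        then show ?thesis using cl x' 2 by (auto simp: principal_left_def)
      qed
    qed
    ultimately show ?thesis using car d by (auto simp: green_L_def green_R_def)
  qed
qed

lemma green_R_L_subset:
  assumes "is_semigroup S"
  shows "green_R S O green_L S \<subseteq> green_L S O green_R S"
proof -
  have "converse (green_R S) = green_R S" "converse (green_L S) = green_L S"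
    by (auto simp: green_R_def green_L_def)
  then have "green_R S O green_L S = converse (green_L S O green_R S)"
    by (simp add: converse_relcomp)
  also have "\<dots> \<subseteq> converse (green_R S O green_L S)"
    using green_L_R_subset[OF assms] by (simp only: converse_mono)
  also have "\<dots> = green_L S O green_R S"
    using \<open>converse (green_R S) = _\<close> \<open>converse (green_L S) = _\<close> by (simp add: converse_relcomp)
  finally show ?thesis .
qed

lemma green_D_alt:
  assumes "is_semigroup S"
  shows "green_D S = green_R S O green_L S"
  using green_L_R_subset[OF assms] green_R_L_subset[OF assms] by (auto simp: green_D_def)

lemma equiv_green_D:
  assumes "is_semigroup S"
  shows "equiv (carrier S) (green_D S)"
proof (rule equivI)
  show "green_D S \<subseteq> carrier S \<times> carrier S"
    by (auto simp: green_D_def green_L_def green_R_def)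
  show "refl_on (carrier S) (green_D S)"
    by (auto simp: refl_on_def green_D_def green_L_def green_R_def)
  have sy: "converse (green_R S) = green_R S" "converse (green_L S) = green_L S"
    by (auto simp: green_R_def green_L_def)
  have "converse (green_D S) = green_D S"
    by (subst green_D_alt[OF assms]) (simp add: converse_relcomp sy green_D_def)
  then show "sym (green_D S)" by (simp add: sym_conv_converse_eq)
  have LL: "green_L S O green_L S \<subseteq> green_L S" and RR: "green_R S O green_R S \<subseteq> green_R S"
    by (auto simp: green_L_def green_R_def)
  have "green_D S O green_D S = green_L S O (green_R S O green_L S) O green_R S"
    by (simp add: green_D_def O_assoc)
  also have "\<dots> = (green_L S O green_L S) O (green_R S O green_R S)"
    by (simp add: green_D_alt[OF assms, symmetric] green_D_def O_assoc)
  also have "\<dots> \<subseteq> green_D S"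
    unfolding green_D_def using LL RR by (rule relcomp_mono)
  finally show "trans (green_D S)" by (simp add: trans_O_subset relcomp.simps trans_def) blast
qed

text \<open>Partial maps act on the right: the product of \<open>\<alpha>\<close> and \<open>\<beta>\<close> applies \<open>\<alpha>\<close> first.
  Injectivity is required on the domain only, since \<^term>\<open>None\<close> may be attained repeatedly.\<close>

definition IZ :: "(int \<rightharpoonup> int) monoid" where
  "IZ = \<lparr>carrier = {\<alpha>. inj_on \<alpha> (dom \<alpha>) \<and> mono_on (dom \<alpha>) (\<lambda>n. the (\<alpha> n)) \<and>
                       finite (UNIV - dom \<alpha>) \<and> finite (UNIV - ran \<alpha>)},
         mult = (\<lambda>\<alpha> \<beta>. \<beta> \<circ>\<^sub>m \<alpha>),
         one = Some\<rparr>"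

end

theory Submission
  imports Defs
begin

text \<open>Every cofinite subset of the integers is the range of a strictly increasing total map.
  Hence every element of the monoid has the form \<open>e n \<mapsto> f n\<close> for two such maps \<open>e\<close>, \<open>f\<close>, and
  the product of \<open>e n \<mapsto> f n\<close> and \<open>f n \<mapsto> g n\<close> is \<open>e n \<mapsto> g n\<close>. Consequently
  \<open>e n \<mapsto> f n\<close> is \<open>\<L>\<close>-related to \<open>g n \<mapsto> f n\<close>, which is \<open>\<R>\<close>-related to \<open>g n \<mapsto> h n\<close>.\<close>

lemma (in monoid) is_semigroup: "is_semigroup G"
  by (simp add: is_semigroup_def m_assoc)

lemma principal_left_subset:
  assumes "is_semigroup S" "a \<in> carrier S" "s \<in> carrier S"
  shows "principal_left S (s \<otimes>\<^bsub>S\<^esub> a) \<subseteq> principal_left S a"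
proof -
  have "r \<otimes>\<^bsub>S\<^esub> (s \<otimes>\<^bsub>S\<^esub> a) = (r \<otimes>\<^bsub>S\<^esub> s) \<otimes>\<^bsub>S\<^esub> a" "r \<otimes>\<^bsub>S\<^esub> s \<in> carrier S"
    if "r \<in> carrier S" for r
    using assms that by (simp_all add: is_semigroup_def)
  then show ?thesis using assms(3) by (auto simp: principal_left_def)
qed

text \<open>This reduces Green's relation to exhibiting two multipliers: each multiplication can
  only shrink the principal left ideal, so two of them force equality.\<close>

lemma green_LI:
  assumes "is_semigroup S" "a \<in> carrier S" "b \<in> carrier S" "s \<in> carrier S" "t \<in> carrier S"
    and a: "a = s \<otimes>\<^bsub>S\<^esub> b" and b: "b = t \<otimes>\<^bsub>S\<^esub> a"
  shows "(a, b) \<in> green_L S"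
proof -
  have "principal_left S a \<subseteq> principal_left S b"
    by (subst a) (intro principal_left_subset assms(1,3,4))
  moreover have "principal_left S b \<subseteq> principal_left S a"
    by (subst b) (intro principal_left_subset assms(1,2,5))
  ultimately show ?thesis using assms(2,3) by (simp add: green_L_def)
qed

lemma principal_right_subset:
  assumes "is_semigroup S" "a \<in> carrier S" "s \<in> carrier S"
  shows "principal_right S (a \<otimes>\<^bsub>S\<^esub> s) \<subseteq> principal_right S a"
proof -
  have "(a \<otimes>\<^bsub>S\<^esub> s) \<otimes>\<^bsub>S\<^esub> r = a \<otimes>\<^bsub>S\<^esub> (s \<otimes>\<^bsub>S\<^esub> r)" "s \<otimes>\<^bsub>S\<^esub> r \<in> carrier S"
    if "r \<in> carrier S" for r
    using assms that by (simp_all add: is_semigroup_def)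
  then show ?thesis using assms(3) by (auto simp: principal_right_def)
qed

lemma green_RI:
  assumes "is_semigroup S" "a \<in> carrier S" "b \<in> carrier S" "s \<in> carrier S" "t \<in> carrier S"
    and a: "a = b \<otimes>\<^bsub>S\<^esub> s" and b: "b = a \<otimes>\<^bsub>S\<^esub> t"
  shows "(a, b) \<in> green_R S"
proof -
  have "principal_right S a \<subseteq> principal_right S b"
    by (subst a) (intro principal_right_subset assms(1,3,4))
  moreover have "principal_right S b \<subseteq> principal_right S a"
    by (subst b) (intro principal_right_subset assms(1,2,5))
  ultimately show ?thesis using assms(2,3) by (simp add: green_R_def)
qed

lemma map_comp_in_IZ:
  assumes "\<alpha> \<in> carrier IZ" "\<beta> \<in> carrier IZ"
  shows "\<beta> \<circ>\<^sub>m \<alpha> \<in> carrier IZ"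
proof -
  have inj: "inj_on \<alpha> (dom \<alpha>)" "inj_on \<beta> (dom \<beta>)"
    and mono: "mono_on (dom \<alpha>) (\<lambda>n. the (\<alpha> n))" "mono_on (dom \<beta>) (\<lambda>n. the (\<beta> n))"
    and fin: "finite (UNIV - dom \<alpha>)" "finite (UNIV - dom \<beta>)"
      "finite (UNIV - ran \<alpha>)" "finite (UNIV - ran \<beta>)"
    using assms by (auto simp: IZ_def)
  have dom: "dom (\<beta> \<circ>\<^sub>m \<alpha>) = {x. \<exists>y z. \<alpha> x = Some y \<and> \<beta> y = Some z}"
    by (auto simp: map_comp_def dom_def split: option.splits)
  have "inj_on (\<beta> \<circ>\<^sub>m \<alpha>) (dom (\<beta> \<circ>\<^sub>m \<alpha>))"
    unfolding dom using inj by (fastforce simp: inj_on_def map_comp_def dom_def)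
  moreover have "mono_on (dom (\<beta> \<circ>\<^sub>m \<alpha>)) (\<lambda>n. the ((\<beta> \<circ>\<^sub>m \<alpha>) n))"
    unfolding dom using mono by (fastforce simp: mono_on_def map_comp_def dom_def)
  moreover have "finite (UNIV - dom (\<beta> \<circ>\<^sub>m \<alpha>))"
  proof (rule finite_subset)
    \<comment> \<open>A point is lost either because \<alpha> is undefined there or because \<alpha>
      sends it outside \<open>dom \<beta>\<close>; injectivity of \<alpha> keeps the second set
      finite.\<close>
    show "UNIV - dom (\<beta> \<circ>\<^sub>m \<alpha>) \<subseteq> (UNIV - dom \<alpha>) \<union> (\<alpha> -` Some ` (UNIV - dom \<beta>) \<inter> dom \<alpha>)"
      unfolding dom by (auto simp: dom_def)
    show "finite ((UNIV - dom \<alpha>) \<union> (\<alpha> -` Some ` (UNIV - dom \<beta>) \<inter> dom \<alpha>))"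
      using fin inj by (auto intro!: finite_vimage_IntI)
  qed
  moreover have "finite (UNIV - ran (\<beta> \<circ>\<^sub>m \<alpha>))"
  proof (rule finite_subset)
    \<comment> \<open>A value of \<beta> that the product misses comes from an argument missed by
      \<alpha>. Where \<beta> is undefined, \<open>the\<close> adds an arbitrary value, harmless in
      an upper bound.\<close>
    show "UNIV - ran (\<beta> \<circ>\<^sub>m \<alpha>) \<subseteq> (UNIV - ran \<beta>) \<union> (\<lambda>y. the (\<beta> y)) ` (UNIV - ran \<alpha>)"
    proof
      fix z assume z: "z \<in> UNIV - ran (\<beta> \<circ>\<^sub>m \<alpha>)"
      show "z \<in> (UNIV - ran \<beta>) \<union> (\<lambda>y. the (\<beta> y)) ` (UNIV - ran \<alpha>)"
      proof (cases "z \<in> ran \<beta>")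
        case True
        then obtain y where y: "\<beta> y = Some z" by (auto simp: ran_def)
        have "y \<notin> ran \<alpha>"
        proof
          assume "y \<in> ran \<alpha>"
          then obtain x where "\<alpha> x = Some y" by (auto simp: ran_def)
          then have "(\<beta> \<circ>\<^sub>m \<alpha>) x = Some z" using y by simp
          then show False using z by (auto simp: ran_def)
        qed
        then show ?thesis using y by force
      qed simp
    qed
    show "finite ((UNIV - ran \<beta>) \<union> (\<lambda>y. the (\<beta> y)) ` (UNIV - ran \<alpha>))"
      using fin by simp
  qed
  ultimately show ?thesis by (simp add: IZ_def)
qed

lemma monoid_IZ: "monoid IZ"
proof
  show "\<one>\<^bsub>IZ\<^esub> \<in> carrier IZ"
    by (auto simp: IZ_def dom_def ran_def mono_on_def)
  show "x \<otimes>\<^bsub>IZ\<^esub> y \<in> carrier IZ" if "x \<in> carrier IZ" "y \<in> carrier IZ" for x y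
    using map_comp_in_IZ[OF that] by (simp add: IZ_def)
qed (auto simp: IZ_def map_comp_def fun_eq_iff split: option.splits)

text \<open>A point \<open>e q\<close> is removed from the range of \<open>e\<close> by skipping the argument \<open>q\<close>.\<close>

lemma cofinite_eq_range_strict_mono:
  fixes F :: "int set"
  assumes "finite F"
  shows "\<exists>e :: int \<Rightarrow> int. strict_mono e \<and> range e = - F"
  using assms
proof induction
  case empty
  show ?case by (intro exI[of _ "\<lambda>n. n"]) (simp add: strict_mono_def)
next
  case (insert p F)
  then obtain e :: "int \<Rightarrow> int" where e: "strict_mono e" "range e = - F" by blast
  with insert obtain q where q: "p = e q" by blast
  define s where "s n = (if n < q then n else n + 1)" for n
  have "strict_mono s" by (auto simp: strict_mono_def s_def)
  then have mono: "strict_mono (e \<circ> s)" using e by (simp add: strict_mono_def)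
  \<comment> \<open>The preimage of \<open>n\<close> under \<open>s\<close> is \<open>n\<close>
    itself below \<open>q\<close> and \<open>n - 1\<close> above it.\<close>
  have "n \<in> range s" if "n \<noteq> q" for n
    using that rangeI[of s n] rangeI[of s "n - 1"] by (auto simp: s_def split: if_splits)
  then have "range s = - {q}" by (auto simp: s_def split: if_splits)
  then have "range (e \<circ> s) = e ` (- {q})" by (metis image_comp)
  also have "\<dots> = range e - {p}"
    using q strict_mono_imp_inj_on[OF e(1)] by (auto simp: inj_def)
  also have "\<dots> = - insert p F" using e(2) by auto
  finally show ?case using mono by blast
qed

text \<open>For injective \<open>e\<close> this is the inverse of \<open>e\<close> followed by
  \<open>f\<close>, so that domain and range are indexed by the same copy of the integers.\<close>

definition matching :: "(int \<Rightarrow> int) \<Rightarrow> (int \<Rightarrow> int) \<Rightarrow> int \<rightharpoonup> int" where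
  "matching e f x = (if x \<in> range e then Some (f (inv_into UNIV e x)) else None)"

definition cofinite_embedding :: "(int \<Rightarrow> int) \<Rightarrow> bool" where
  "cofinite_embedding e \<longleftrightarrow> strict_mono e \<and> finite (- range e)"

lemma matching_apply [simp]: "inj e \<Longrightarrow> matching e f (e n) = Some (f n)"
  by (simp add: matching_def)

lemma dom_matching [simp]: "dom (matching e f) = range e"
  by (auto simp: matching_def dom_def)

lemma ran_matching: "inj e \<Longrightarrow> ran (matching e f) = range f"
  unfolding ran_def by (force simp: matching_def)

lemma inj_cofinite_embedding: "cofinite_embedding e \<Longrightarrow> inj e"
  by (simp add: cofinite_embedding_def strict_mono_imp_inj_on)

lemma matching_in_IZ:
  assumes "cofinite_embedding e" "cofinite_embedding f"
  shows "matching e f \<in> carrier IZ"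
proof -
  note inj = assms[THEN inj_cofinite_embedding]
  have "inj_on (matching e f) (range e)"
    by (rule inj_onI) (use inj in \<open>auto simp: inj_eq\<close>)
  \<comment> \<open>Being strictly monotone on a linear order, \<open>e\<close> reflects the order:
    \<open>e n\<close> \<le> \<open>e m\<close> gives \<open>n\<close> \<le> \<open>m\<close>, hence
    \<open>f n\<close> \<le> \<open>f m\<close>.\<close>
  moreover have "mono_on (range e) (\<lambda>n. the (matching e f n))"
    using assms inj
    by (auto simp: mono_on_def cofinite_embedding_def strict_mono_less_eq)
  ultimately show ?thesis
    using assms inj by (simp add: IZ_def ran_matching cofinite_embedding_def Compl_eq_Diff_UNIV)
qed

text \<open>The range of the first factor is exactly the domain of the second, so no point is lost;
  injectivity of \<open>f\<close> recovers the index \<open>n\<close> from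
  \<open>f n\<close>.\<close>

lemma matching_comp:
  assumes "inj e" "inj f"
  shows "matching e f \<otimes>\<^bsub>IZ\<^esub> matching f g = matching e g"
  using assms by (auto simp: IZ_def map_comp_def fun_eq_iff matching_def)

text \<open>Enumerate the domain increasingly by \<open>e\<close> and read off the values of
  \<alpha> along this enumeration as \<open>f\<close>.\<close>

lemma IZ_eq_matching:
  assumes "\<alpha> \<in> carrier IZ"
  obtains e f where "cofinite_embedding e" "cofinite_embedding f" "\<alpha> = matching e f"
proof -
  have inj: "inj_on \<alpha> (dom \<alpha>)" and mono: "mono_on (dom \<alpha>) (\<lambda>n. the (\<alpha> n))"
    and fin: "finite (- dom \<alpha>)" "finite (- ran \<alpha>)"
    using assms by (auto simp: IZ_def Compl_eq_Diff_UNIV)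
  obtain e :: "int \<Rightarrow> int" where e: "strict_mono e" "range e = dom \<alpha>"
    using cofinite_eq_range_strict_mono[OF fin(1)] by auto
  define f where "f n = the (\<alpha> (e n))" for n
  have \<alpha>e: "\<alpha> (e n) = Some (f n)" for n
    using e(2) f_def by (metis domIff option.collapse rangeI)
  have inj_e: "inj e" using e(1) by (rule strict_mono_imp_inj_on)
  have eq: "\<alpha> = matching e f"
  proof
    fix x
    show "\<alpha> x = matching e f x"
    proof (cases "x \<in> range e")
      case True
      then show ?thesis using \<alpha>e inj_e by auto
    next
      case False
      then show ?thesis using e(2) by (auto simp: matching_def)
    qed
  qed
  \<comment> \<open>As \<alpha> and \<open>e\<close> are both monotone and injective, so is
    \<open>f\<close>; together this makes \<open>f\<close> strictly monotone.\<close>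
  have "mono f"
    unfolding f_def
    by (intro monoI mono_onD[OF mono]) (use e in \<open>auto simp: strict_mono_less_eq\<close>)
  moreover have "inj f"
    using inj \<alpha>e inj_e e(2) by (metis (mono_tags, lifting) inj_on_def rangeI)
  ultimately have "strict_mono f" by (simp add: strict_mono_iff_mono)
  moreover have "range f = ran \<alpha>" using eq ran_matching inj_e by simp
  ultimately show thesis using that[OF _ _ eq] e fin by (simp add: cofinite_embedding_def)
qed

lemma green_D_IZ:
  assumes "\<alpha> \<in> carrier IZ" "\<beta> \<in> carrier IZ"
  shows "(\<alpha>, \<beta>) \<in> green_D IZ"
proof -
  obtain e f where ef: "cofinite_embedding e" "cofinite_embedding f" "\<alpha> = matching e f"
    using assms(1) by (rule IZ_eq_matching)
  obtain g h where gh: "cofinite_embedding g" "cofinite_embedding h" "\<beta> = matching g h"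
    using assms(2) by (rule IZ_eq_matching)
  note rules = monoid.is_semigroup[OF monoid_IZ] matching_in_IZ ef(1,2) gh(1,2)
    matching_comp[symmetric] inj_cofinite_embedding
  \<comment> \<open>Left multipliers exchange the domain enumeration \<open>e\<close> for
    \<open>g\<close> and back; the right multipliers below do the same for the range enumerations
    \<open>f\<close> and \<open>h\<close>.\<close>
  have "(matching e f, matching g f) \<in> green_L IZ"
    by (rule green_LI[where s = "matching e g" and t = "matching g e"]) (intro rules)+
  moreover have "(matching g f, matching g h) \<in> green_R IZ"
    by (rule green_RI[where s = "matching h f" and t = "matching f h"]) (intro rules)+
  ultimately show ?thesis unfolding ef(3) gh(3) green_D_def by blast
qed

theorem proposition2p3:
  "monoid IZ \<and> is_semigroup IZ \<and> bisimple IZ"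
proof (intro conjI)
  show "monoid IZ" by (rule monoid_IZ)
  then show semigroup: "is_semigroup IZ" by (rule monoid.is_semigroup)
  have "green_D IZ = carrier IZ \<times> carrier IZ"
    using green_D_IZ equivE[OF equiv_green_D[OF semigroup]] by blast
  \<comment> \<open>The quotient of an empty carrier would have no class at all, so a single class
    requires an element.\<close>
  moreover have "carrier IZ \<noteq> {}" using monoid.one_closed[OF monoid_IZ] by blast
  ultimately have "carrier IZ // green_D IZ = {carrier IZ}"
    by (auto simp: quotient_def)
  then show "bisimple IZ" by (auto simp: bisimple_def)
qed

end
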